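(* Let $n,k$ be positive integers such that $n\ge 2k+2$, and let $G\in\mathcal{G}_{n,k}$. Then: (i) For $\alpha=0$, $$\mu_\alpha(G)\ge \frac{n-2+\sqrt{n^2+4n-4k-4}}{2},$$ with equality if and only if $G\cong K(n,k,n-k-1)$ or $G\cong K(n,k,1)$. (ii) For $0<\alpha<1$, $$\mu_\alpha(G)\ge \frac{n-2+\alpha+\alpha n+\sqrt{(1-\alpha)^2n^2+(2\alpha^2-6\alpha+4)n+(\alpha^2+4\alpha-4)-4(1-\alpha)k}}{2},$$ with equality if and only if $G\cong K(n,k,1)$.
   Context: Digraphs are finite and simple (no loops, no multiple arcs; two opposite arcs $(u,v),(v,u)$ are allowed). A digraph is strongly connected if for every ordered pair of vertices there is a directed path from the first to the second. For a strongly connected digraph $G$ with vertices $v_1,\dots,v_n$, $D(G)=(d_{ij})$ is the distance matrix, where $d_{ij}$ is the length of a shortest directed path from $v_i$ to $v_j$; $D_i=\sum_{j=1}^n d_{ij}$ is the transmission of $v_i$; $Diag(Tr)=\mathrm{diag}(D_1,\dots,D_n)$; and $D_\alpha(G)=\alpha\, Diag(Tr)+(1-\alpha)D(G)$. The $D_\alpha$ spectral radius $\mu_\alpha(G)$ is the spectral radius of $D_\alpha(G)$, i.e. its eigenvalue of largest modulus. The vertex connectivity $\kappa(G)$ of a strongly connected digraph $G$ is the minimum number of vertices whose removal destroys strong connectivity (with value $n-1$ for the complete digraph on $n$ vertices). $\mathcal{G}_{n,k}$ is the set of strongly connected digraphs of order $n$ with $\kappa(G)=k$. For $1\le m\le n-k-1$,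 $K(n,k,m)$ is the digraph $\overset{\longleftrightarrow}{K_k}\vee(\overset{\longleftrightarrow}{K_{n-k-m}}\cup\overset{\longleftrightarrow}{K_m})+E$ with $E=\{(u,v):u\in V(\overset{\longleftrightarrow}{K_m}),\,v\in V(\overset{\longleftrightarrow}{K_{n-k-m}})\}$. Here $\overset{\longleftrightarrow}{K_r}$ is the complete digraph on $r$ vertices (both arcs between every two distinct vertices), $\cup$ is disjoint union, $G_1\vee G_2$ is the join (disjoint union together with all arcs in both directions between $G_1$ and $G_2$), and $+E$ means adding the arcs of $E$. *)

theory Defs
  imports
    "Graph_Theory.Graph_Theory"
    "Jordan_Normal_Form.Spectral_Radius"
begin

text \<open>
  Finite simple digraphs are the \<^locale>\<open>digraph\<close>s of the Graph Theory entry (finite, loop-free, no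
  parallel arcs).
\<close>

definition dg_distance :: "('a, 'b) pre_digraph \<Rightarrow> 'a \<Rightarrow> 'a \<Rightarrow> nat" where
  "dg_distance G u v = (LEAST l. \<exists>p. pre_digraph.apath G u p v \<and> length p = l)"

definition transmission :: "('a, 'b) pre_digraph \<Rightarrow> 'a \<Rightarrow> nat" where
  "transmission G u = (\<Sum>v\<in>verts G. dg_distance G u v)"

text \<open>
  The matrices depend on an enumeration \<open>vs\<close> of the vertices, intended to satisfy
  \<open>distinct vs\<close> and \<open>set vs = verts G\<close>; row and column \<open>i\<close> belong to the vertex \<open>vs ! i\<close>.
\<close>

definition distance_matrix :: "('a, 'b) pre_digraph \<Rightarrow> 'a list \<Rightarrow> real mat" where
  "distance_matrix G vs =
     mat (length vs) (length vs) (\<lambda>(i, j). real (dg_distance G (vs ! i) (vs ! j)))"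

definition transmission_matrix :: "('a, 'b) pre_digraph \<Rightarrow> 'a list \<Rightarrow> real mat" where
  "transmission_matrix G vs =
     mat (length vs) (length vs) (\<lambda>(i, j). if i = j then real (transmission G (vs ! i)) else 0)"

definition D_alpha :: "real \<Rightarrow> ('a, 'b) pre_digraph \<Rightarrow> 'a list \<Rightarrow> real mat" where
  "D_alpha \<alpha> G vs = \<alpha> \<cdot>\<^sub>m transmission_matrix G vs + (1 - \<alpha>) \<cdot>\<^sub>m distance_matrix G vs"

definition mu_alpha :: "real \<Rightarrow> ('a, 'b) pre_digraph \<Rightarrow> 'a list \<Rightarrow> real" where
  "mu_alpha \<alpha> G vs = spectral_radius (map_mat complex_of_real (D_alpha \<alpha> G vs))"

text \<open>
  The graph on no vertices is not \<^const>\<open>strongly_connected\<close>, but this never affects the minimum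
  below: in a non-complete digraph on \<open>n\<close> vertices, deleting all vertices except two
  between which at least one of the two arcs is missing already destroys strong connectivity with
  \<open>n - 2\<close> deletions.
\<close>

definition vertex_connectivity :: "('a, 'b) pre_digraph \<Rightarrow> nat" where
  "vertex_connectivity G =
     (if complete_digraph (card (verts G)) G then card (verts G) - 1
      else LEAST c. \<exists>S. S \<subseteq> verts G \<and> card S = c \<and>
             \<not> strongly_connected (induce_subgraph G (verts G - S)))"

definition digraphs_with_connectivity :: "nat \<Rightarrow> nat \<Rightarrow> ('a, 'b) pre_digraph set" where
  "digraphs_with_connectivity n k =
     {G. digraph G \<and> strongly_connected G \<and> card (verts G) = n \<and> vertex_connectivity G = k}"

definition complete_dg :: "nat \<Rightarrow> nat pair_pre_digraph" where
  "complete_dg r = \<lparr>pverts = {..<r}, parcs = {(u, v). u < r \<and> v < r \<and> u \<noteq> v}\<rparr>"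

definition disjoint_union_dg ::
    "'a pair_pre_digraph \<Rightarrow> 'b pair_pre_digraph \<Rightarrow> ('a + 'b) pair_pre_digraph" where
  "disjoint_union_dg G H =
     \<lparr>pverts = pverts G <+> pverts H,
      parcs = map_prod Inl Inl ` parcs G \<union> map_prod Inr Inr ` parcs H\<rparr>"

definition add_arcs_dg :: "'a pair_pre_digraph \<Rightarrow> 'a rel \<Rightarrow> 'a pair_pre_digraph" where
  "add_arcs_dg G E = \<lparr>pverts = pverts G, parcs = parcs G \<union> E\<rparr>"

definition join_dg ::
    "'a pair_pre_digraph \<Rightarrow> 'b pair_pre_digraph \<Rightarrow> ('a + 'b) pair_pre_digraph" where
  "join_dg G H =
     add_arcs_dg (disjoint_union_dg G H)
       (Inl ` pverts G \<times> Inr ` pverts H \<union> Inr ` pverts H \<times> Inl ` pverts G)"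

text \<open>
  The middle summand is the complete digraph on \<open>n - k - m\<close> vertices, the last one that on \<open>m\<close>
  vertices; the definition is meant for \<open>1 \<le> m \<le> n - k - 1\<close>.
\<close>

definition K_digraph :: "nat \<Rightarrow> nat \<Rightarrow> nat \<Rightarrow> (nat + nat + nat) pair_pre_digraph" where
  "K_digraph n k m =
     add_arcs_dg
       (join_dg (complete_dg k) (disjoint_union_dg (complete_dg (n - k - m)) (complete_dg m)))
       {(Inr (Inr u), Inr (Inl v)) | u v. u \<in> pverts (complete_dg m) \<and>
          v \<in> pverts (complete_dg (n - k - m))}"

end

theory Submission
  imports Defs
begin

text \<open>
  Deleting a minimum vertex cut of \<open>k\<close> vertices from \<open>G\<close> leaves two nonempty sides \<open>A\<close> and \<open>B\<close>
  with no arc from \<open>A\<close> to \<open>B\<close> (\<open>vertex_cut_sides\<close>). Hence every distance in \<open>G\<close> is at least the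
  corresponding \<^emph>\<open>split distance\<close>, which is \<open>2\<close> from \<open>A\<close> to \<open>B\<close> and \<open>1\<close> between all other distinct
  vertices, and all of these are attained exactly when \<open>G\<close> misses no arc but those from \<open>A\<close> to
  \<open>B\<close>, that is, when \<open>G\<close> is isomorphic to \<open>K(n,k,m)\<close> with \<open>m = |B|\<close>.

  Let \<open>t\<close> be the positive root of \<open>t\<^sup>2 + ((1 - \<alpha>) n - \<alpha>) t = (1 - \<alpha>) (n - k - 1)\<close>; the bound
  of the theorem is \<open>\<rho> = n - 1 + t\<close>. Rather than computing the spectral radii of all \<open>K(n,k,m)\<close>
  and comparing them, the proof tests \<open>D\<^sub>\<alpha>(G)\<close> on one explicit positive vector \<open>w\<close>, constant on
  \<open>A\<close> and on its complement. With split distances instead of the distances of \<open>G\<close>, the image of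
  \<open>w\<close> is \<open>\<rho> w\<close> outside \<open>A\<close> and exceeds it on \<open>A\<close> by \<open>(m - 1) (\<alpha> t + (1 - \<alpha>) (|A| - 1)) \<ge> 0\<close>
  (\<open>split_distance_row_sum_excess\<close>). So \<open>D\<^sub>\<alpha>(G) w \<ge> \<rho> w\<close>, with equality if and only if \<open>G\<close> is
  \<open>K(n,k,m)\<close> and either \<open>m = 1\<close>, or \<open>\<alpha> = 0\<close> and \<open>|A| = 1\<close>, the latter meaning \<open>m = n - k - 1\<close>.

  What remains is to read off the spectral radius from such a vector. For a real matrix with
  nonnegative entries and positive off-diagonal entries, \<open>M w \<ge> \<rho> w\<close> implies that the spectral
  radius is at least \<open>\<rho>\<close>, and it equals \<open>\<rho>\<close> if and only if \<open>M w = \<rho> w\<close>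
  (\<open>spectral_radius_ge_subinvariant\<close>, \<open>spectral_radius_gt_subinvariant\<close>,
  \<open>spectral_radius_eq_positive_eigenvector\<close>).
\<close>

section \<open>Subinvariant vectors and the spectral radius\<close>

lemma spectral_radius_attained:
  fixes A :: "complex mat"
  assumes "A \<in> carrier_mat n n" "n \<noteq> 0"
  obtains \<theta> where "eigenvalue A \<theta>" "cmod \<theta> = spectral_radius A"
  using spectral_radius_mem_max(1)[OF assms(1)] assms(2) unfolding spectrum_def by auto

lemma eigenvalue_le_spectral_radius:
  fixes A :: "complex mat"
  assumes "A \<in> carrier_mat n n" "n \<noteq> 0" "eigenvalue A \<theta>"
  shows "cmod \<theta> \<le> spectral_radius A"
  using spectral_radius_mem_max(2)[OF assms(1), of "cmod \<theta>"] assms unfolding spectrum_def by auto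

lemma eigenvalue_smult:
  fixes A :: "complex mat"
  assumes A: "A \<in> carrier_mat n n" and e: "eigenvalue (c \<cdot>\<^sub>m A) \<theta>" and "c \<noteq> 0"
  shows "eigenvalue A (\<theta> / c)"
proof -
  from e obtain v where v: "v \<in> carrier_vec n" "v \<noteq> 0\<^sub>v n" "(c \<cdot>\<^sub>m A) *\<^sub>v v = \<theta> \<cdot>\<^sub>v v"
    using A unfolding eigenvalue_def eigenvector_def by auto
  have "c \<cdot>\<^sub>v (A *\<^sub>v v) = (c \<cdot>\<^sub>m A) *\<^sub>v v"
    using v(1) A by (intro eq_vecI) auto
  then have "c \<cdot>\<^sub>v (A *\<^sub>v v) = \<theta> \<cdot>\<^sub>v v" using v(3) by simp
  then have "(1 / c) \<cdot>\<^sub>v (c \<cdot>\<^sub>v (A *\<^sub>v v)) = (1 / c) \<cdot>\<^sub>v (\<theta> \<cdot>\<^sub>v v)" by simp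
  then have "A *\<^sub>v v = (\<theta> / c) \<cdot>\<^sub>v v"
    using \<open>c \<noteq> 0\<close> by (simp add: smult_smult_assoc)
  then show ?thesis using v A unfolding eigenvalue_def eigenvector_def by auto
qed

lemma pow_mat_nonneg:
  fixes B :: "real mat"
  assumes B: "B \<in> carrier_mat n n" and nonneg: "\<And>i j. i < n \<Longrightarrow> j < n \<Longrightarrow> B $$ (i, j) \<ge> 0"
    and "i < n" "j < n"
  shows "(B ^\<^sub>m k) $$ (i, j) \<ge> 0"
  using assms(3,4)
proof (induction k arbitrary: i j)
  case 0
  then show ?case using B by (simp add: one_mat_def)
next
  case (Suc k)
  have "(B ^\<^sub>m Suc k) $$ (i, j) = (\<Sum>l<n. (B ^\<^sub>m k) $$ (i, l) * B $$ (l, j))"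
    using B Suc.prems pow_carrier_mat[OF B, of k]
    by (simp add: scalar_prod_def lessThan_atLeast0)
  then show ?case using Suc nonneg by (auto intro!: sum_nonneg mult_nonneg_nonneg)
qed

lemma pow_mat_subinvariant:
  fixes B :: "real mat"
  assumes B: "B \<in> carrier_mat n n" and nonneg: "\<And>i j. i < n \<Longrightarrow> j < n \<Longrightarrow> B $$ (i, j) \<ge> 0"
    and sub: "\<And>i. i < n \<Longrightarrow> q * w i \<le> (\<Sum>j<n. B $$ (i, j) * w j)" and "q \<ge> 0"
    and "i < n"
  shows "q ^ k * w i \<le> (\<Sum>j<n. (B ^\<^sub>m k) $$ (i, j) * w j)"
  using \<open>i < n\<close>
proof (induction k arbitrary: i)
  case 0
  have "(\<Sum>j<n. (B ^\<^sub>m 0) $$ (i, j) * w j) = (\<Sum>j<n. if j = i then w j else 0)"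
    using B 0 by (intro sum.cong) (auto simp: one_mat_def)
  then show ?case using 0 by simp
next
  case (Suc k)
  have "q ^ Suc k * w i = q * (q ^ k * w i)" by simp
  also have "\<dots> \<le> q * (\<Sum>j<n. (B ^\<^sub>m k) $$ (i, j) * w j)"
    using Suc \<open>q \<ge> 0\<close> by (intro mult_left_mono) auto
  also have "\<dots> = (\<Sum>l<n. (B ^\<^sub>m k) $$ (i, l) * (q * w l))"
    by (simp add: sum_distrib_left algebra_simps)
  also have "\<dots> \<le> (\<Sum>l<n. (B ^\<^sub>m k) $$ (i, l) * (\<Sum>j<n. B $$ (l, j) * w j))"
    by (intro sum_mono mult_left_mono) (use Suc.prems sub pow_mat_nonneg[OF B nonneg] in auto)
  also have "\<dots> = (\<Sum>j<n. (\<Sum>l<n. (B ^\<^sub>m k) $$ (i, l) * B $$ (l, j)) * w j)"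
    unfolding sum_distrib_left sum_distrib_right by (subst sum.swap) (simp add: mult.assoc)
  also have "\<dots> = (\<Sum>j<n. (B ^\<^sub>m Suc k) $$ (i, j) * w j)"
    using B Suc.prems pow_carrier_mat[OF B, of k]
    by (intro sum.cong) (simp_all add: scalar_prod_def lessThan_atLeast0)
  finally show ?case .
qed

text \<open>
  The Collatz--Wielandt lower bound, here without Perron--Frobenius theory. If the spectral radius
  were below \<open>\<rho>\<close>, then for some \<open>r < \<rho>\<close> the powers of \<open>B = M / r\<close> would stay bounded, by the
  Jordan normal form; but subinvariance makes the \<open>k\<close>-th power of \<open>B\<close> stretch \<open>w\<close> by at least
  \<open>(\<rho> / r) ^ k\<close>.
\<close>

lemma spectral_radius_ge_subinvariant:
  fixes M :: "real mat"
  assumes M: "M \<in> carrier_mat n n" and nonneg: "\<And>i j. i < n \<Longrightarrow> j < n \<Longrightarrow> M $$ (i, j) \<ge> 0"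
    and w: "\<And>i. i < n \<Longrightarrow> w i > 0" and "n \<noteq> 0"
    and sub: "\<And>i. i < n \<Longrightarrow> \<rho> * w i \<le> (\<Sum>j<n. M $$ (i, j) * w j)"
  shows "\<rho> \<le> spectral_radius (map_mat complex_of_real M)"
proof (rule ccontr)
  let ?N = "map_mat complex_of_real M"
  have N: "?N \<in> carrier_mat n n" using M by simp
  assume less: "\<not> \<rho> \<le> spectral_radius ?N"
  obtain r where r: "spectral_radius ?N < r" "r < \<rho>" using less dense[of "spectral_radius ?N" \<rho>] by auto
  obtain \<theta> where "cmod \<theta> = spectral_radius ?N" using spectral_radius_attained[OF N \<open>n \<noteq> 0\<close>] by metis
  then have r0: "r > 0" using r(1) norm_ge_zero[of \<theta>] by linarith
  define B where "B = (1 / r) \<cdot>\<^sub>m M"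
  let ?C = "map_mat complex_of_real B"
  have B: "B \<in> carrier_mat n n" using M by (simp add: B_def)
  have C: "?C \<in> carrier_mat n n" using B by simp
  have C_eq: "?C = complex_of_real (1 / r) \<cdot>\<^sub>m ?N"
    using M by (intro eq_matI) (auto simp: B_def)
  obtain \<mu> where \<mu>: "eigenvalue ?C \<mu>" "cmod \<mu> = spectral_radius ?C"
    using spectral_radius_attained[OF C \<open>n \<noteq> 0\<close>] by metis
  have "eigenvalue ?N (\<mu> / complex_of_real (1 / r))"
    using r0 by (intro eigenvalue_smult[OF N \<mu>(1)[unfolded C_eq]]) simp
  then have "cmod (\<mu> / complex_of_real (1 / r)) \<le> spectral_radius ?N"
    by (rule eigenvalue_le_spectral_radius[OF N \<open>n \<noteq> 0\<close>])
  then have "cmod \<mu> * r \<le> spectral_radius ?N" using r0 by (simp add: norm_divide norm_mult)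
  then have "cmod \<mu> * r < 1 * r" using r by linarith
  then have "spectral_radius ?C < 1" using \<mu>(2) r0 by (subst (asm) mult_less_cancel_right_pos) simp_all
  then obtain c where c: "\<And>k. norm_bound (?C ^\<^sub>m k) c"
    using spectral_radius_jnf_norm_bound_less_1_upper_triangular[OF C] by blast
  have bound: "(B ^\<^sub>m k) $$ (i, j) \<le> c" if "i < n" "j < n" for k i j
  proof -
    have "?C ^\<^sub>m k = map_mat complex_of_real (B ^\<^sub>m k)"
      using of_real_hom.mat_hom_pow[OF B] by metis
    then have "norm_bound (map_mat complex_of_real (B ^\<^sub>m k)) c" using c[of k] by simp
    then have "\<bar>(B ^\<^sub>m k) $$ (i, j)\<bar> \<le> c"
      using that carrier_matD[OF pow_carrier_mat[OF B, of k]] B by (simp add: norm_bound_def split: if_splits)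
    then show ?thesis by simp
  qed
  define q where "q = \<rho> / r"
  have q: "q > 1" using r r0 by (simp add: q_def)
  have Bn: "B $$ (i, j) \<ge> 0" if "i < n" "j < n" for i j
    using that nonneg M r0 by (simp add: B_def)
  have subB: "q * w i \<le> (\<Sum>j<n. B $$ (i, j) * w j)" if "i < n" for i
  proof -
    have "(\<Sum>j<n. B $$ (i, j) * w j) = (\<Sum>j<n. M $$ (i, j) * w j) / r"
      using that M unfolding sum_divide_distrib by (intro sum.cong) (auto simp: B_def)
    then show ?thesis using sub[OF that] r0 by (simp add: q_def divide_right_mono)
  qed
  have "q ^ k \<le> c * (\<Sum>j<n. w j) / w 0" for k
  proof -
    have "q ^ k * w 0 \<le> (\<Sum>j<n. (B ^\<^sub>m k) $$ (0, j) * w j)"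
      using pow_mat_subinvariant[OF B Bn subB] q \<open>n \<noteq> 0\<close> by simp
    also have "\<dots> \<le> (\<Sum>j<n. c * w j)"
      using bound w \<open>n \<noteq> 0\<close> by (intro sum_mono mult_right_mono) (auto intro: less_imp_le)
    finally show ?thesis using w[of 0] \<open>n \<noteq> 0\<close> by (simp add: sum_distrib_left pos_le_divide_eq)
  qed
  moreover obtain k where "c * (\<Sum>j<n. w j) / w 0 < q ^ k" using real_arch_pow[OF q] by blast
  ultimately show False by (meson not_le)
qed

text \<open>
  For an eigenvector \<open>v\<close> of any complex eigenvalue, compare \<open>\<bar>v\<bar>\<close> with the smallest multiple \<open>R w\<close>
  that dominates it: at a coordinate where the two touch, the row of \<open>M\<close> shows that the modulus of
  the eigenvalue is at most \<open>\<rho>\<close>.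
\<close>

lemma spectral_radius_eq_positive_eigenvector:
  fixes M :: "real mat"
  assumes M: "M \<in> carrier_mat n n" and nonneg: "\<And>i j. i < n \<Longrightarrow> j < n \<Longrightarrow> M $$ (i, j) \<ge> 0"
    and w: "\<And>i. i < n \<Longrightarrow> w i > 0" and "n \<noteq> 0"
    and eig: "\<And>i. i < n \<Longrightarrow> (\<Sum>j<n. M $$ (i, j) * w j) = \<rho> * w i"
  shows "spectral_radius (map_mat complex_of_real M) = \<rho>"
proof (rule antisym)
  let ?N = "map_mat complex_of_real M"
  have N: "?N \<in> carrier_mat n n" using M by simp
  show "\<rho> \<le> spectral_radius ?N"
    using eig by (intro spectral_radius_ge_subinvariant[OF M nonneg w \<open>n \<noteq> 0\<close>]) auto
  obtain \<theta> where \<theta>: "eigenvalue ?N \<theta>" "cmod \<theta> = spectral_radius ?N"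
    using spectral_radius_attained[OF N \<open>n \<noteq> 0\<close>] by metis
  then obtain v where v: "v \<in> carrier_vec n" "v \<noteq> 0\<^sub>v n" "?N *\<^sub>v v = \<theta> \<cdot>\<^sub>v v"
    using M unfolding eigenvalue_def eigenvector_def by auto
  define R where "R = Max ((\<lambda>i. cmod (v $ i) / w i) ` {..<n})"
  have fin: "finite ((\<lambda>i. cmod (v $ i) / w i) ` {..<n})" "(\<lambda>i. cmod (v $ i) / w i) ` {..<n} \<noteq> {}"
    using \<open>n \<noteq> 0\<close> by auto
  obtain i where i: "i < n" "R = cmod (v $ i) / w i" using Max_in[OF fin] unfolding R_def by auto
  have le: "cmod (v $ j) \<le> R * w j" if "j < n" for j
  proof -
    have "cmod (v $ j) / w j \<le> R" using that fin unfolding R_def by (intro Max_ge) auto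
    then show ?thesis using w[OF that] by (simp add: pos_divide_le_eq)
  qed
  have "R > 0"
  proof (rule ccontr)
    assume "\<not> R > 0"
    have "v $ j = 0" if "j < n" for j
    proof -
      have "R * w j \<le> 0" using \<open>\<not> R > 0\<close> w[OF that] by (simp add: mult_nonpos_nonneg)
      then have "cmod (v $ j) \<le> 0" using le[OF that] by linarith
      then show ?thesis by simp
    qed
    then have "v = 0\<^sub>v n" using v(1) by (intro eq_vecI) auto
    then show False using v(2) by simp
  qed
  have "(?N *\<^sub>v v) $ i = (\<Sum>j<n. complex_of_real (M $$ (i, j)) * v $ j)"
    using i(1) M v(1) by (simp add: scalar_prod_def lessThan_atLeast0)
  then have "\<theta> * v $ i = (\<Sum>j<n. complex_of_real (M $$ (i, j)) * v $ j)"
    using v i(1) by simp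
  then have "cmod \<theta> * cmod (v $ i) = cmod (\<Sum>j<n. complex_of_real (M $$ (i, j)) * v $ j)"
    by (metis norm_mult)
  also have "\<dots> \<le> (\<Sum>j<n. cmod (complex_of_real (M $$ (i, j)) * v $ j))" by (rule norm_sum)
  also have "\<dots> \<le> (\<Sum>j<n. M $$ (i, j) * (R * w j))"
    using nonneg[OF i(1)] le by (intro sum_mono) (auto simp: norm_mult intro!: mult_left_mono)
  also have "\<dots> = R * (\<Sum>j<n. M $$ (i, j) * w j)" by (simp add: sum_distrib_left algebra_simps)
  also have "\<dots> = \<rho> * cmod (v $ i)" using eig[OF i(1)] i(2) w[OF i(1)] by simp
  finally have "cmod \<theta> * cmod (v $ i) \<le> \<rho> * cmod (v $ i)" .
  moreover have "cmod (v $ i) > 0" using \<open>R > 0\<close> i w[OF i(1)] by (simp add: zero_less_divide_iff)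
  ultimately show "spectral_radius ?N \<le> \<rho>" using \<theta>(2) by simp
qed

text \<open>
  A strict inequality at one coordinate \<open>i\<close> can be spread to all of them: raising \<open>w\<close> slightly at
  \<open>i\<close> increases every other row, since the off-diagonal entries are positive, and uses up only part
  of the slack in row \<open>i\<close>. The perturbed vector is then subinvariant for some \<open>\<sigma> > \<rho>\<close>.
  Only off-diagonal positivity is assumed because the diagonal of \<open>D\<^sub>\<alpha>\<close> vanishes for \<open>\<alpha> = 0\<close>.
\<close>

lemma spectral_radius_gt_subinvariant:
  fixes M :: "real mat"
  assumes M: "M \<in> carrier_mat n n" and nonneg: "\<And>i j. i < n \<Longrightarrow> j < n \<Longrightarrow> M $$ (i, j) \<ge> 0"
    and pos: "\<And>i j. i < n \<Longrightarrow> j < n \<Longrightarrow> i \<noteq> j \<Longrightarrow> M $$ (i, j) > 0"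
    and w: "\<And>i. i < n \<Longrightarrow> w i > 0"
    and sub: "\<And>i. i < n \<Longrightarrow> \<rho> * w i \<le> (\<Sum>j<n. M $$ (i, j) * w j)"
    and i: "i < n" and strict: "\<rho> * w i < (\<Sum>j<n. M $$ (i, j) * w j)"
  shows "\<rho> < spectral_radius (map_mat complex_of_real M)"
proof -
  define g where "g = (\<Sum>j<n. M $$ (i, j) * w j) - \<rho> * w i"
  \<comment> \<open>The slack \<open>g\<close> must outweigh the growth \<open>\<rho> * \<delta>\<close> of the left-hand side in row \<open>i\<close>.\<close>
  define \<delta> where "\<delta> = g / (1 + \<bar>\<rho>\<bar>)"
  have "g > 0" using strict by (simp add: g_def)
  then have "\<delta> > 0" by (simp add: \<delta>_def add_pos_nonneg)
  have "\<rho> * \<delta> \<le> \<bar>\<rho>\<bar> * \<delta>" using \<open>\<delta> > 0\<close> by (intro mult_right_mono) auto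
  also have "\<dots> < g"
  proof -
    have "g = (1 + \<bar>\<rho>\<bar>) * \<delta>" unfolding \<delta>_def by (simp add: add_nonneg_eq_0_iff)
    then show ?thesis using \<open>\<delta> > 0\<close> by (simp add: algebra_simps)
  qed
  finally have \<delta>g: "\<rho> * \<delta> < g" .
  define u where "u j = w j + (if j = i then \<delta> else 0)" for j
  have u: "u j > 0" if "j < n" for j using w[OF that] \<open>\<delta> > 0\<close> by (auto simp: u_def)
  have row: "(\<Sum>l<n. M $$ (j, l) * u l) = (\<Sum>l<n. M $$ (j, l) * w l) + M $$ (j, i) * \<delta>" for j
  proof -
    have "(\<Sum>l<n. M $$ (j, l) * u l)
        = (\<Sum>l<n. M $$ (j, l) * w l + (if l = i then M $$ (j, l) * \<delta> else 0))"
      by (intro sum.cong) (auto simp: u_def algebra_simps)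
    then show ?thesis using i by (simp add: sum.distrib)
  qed
  have ustrict: "\<rho> * u j < (\<Sum>l<n. M $$ (j, l) * u l)" if "j < n" for j
  proof (cases "j = i")
    case True
    then have "\<rho> * u j = \<rho> * w i + \<rho> * \<delta>" by (simp add: u_def algebra_simps)
    also have "\<dots> < \<rho> * w i + g" using \<delta>g by simp
    also have "\<dots> = (\<Sum>l<n. M $$ (i, l) * w l)" by (simp add: g_def)
    also have "\<dots> \<le> (\<Sum>l<n. M $$ (j, l) * u l)"
      unfolding row using nonneg[OF i i] \<open>\<delta> > 0\<close> True by simp
    finally show ?thesis .
  next
    case False
    have "\<rho> * u j = \<rho> * w j" using False by (simp add: u_def)
    also have "\<dots> \<le> (\<Sum>l<n. M $$ (j, l) * w l)" by (rule sub[OF that])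
    also have "\<dots> < (\<Sum>l<n. M $$ (j, l) * u l)"
      unfolding row using pos[OF that i False] \<open>\<delta> > 0\<close> by simp
    finally show ?thesis .
  qed
  define \<sigma> where "\<sigma> = Min ((\<lambda>j. (\<Sum>l<n. M $$ (j, l) * u l) / u j) ` {..<n})"
  let ?Q = "(\<lambda>j. (\<Sum>l<n. M $$ (j, l) * u l) / u j) ` {..<n}"
  have fin: "finite ?Q" "?Q \<noteq> {}" using i by auto
  obtain j where j: "j < n" "\<sigma> = (\<Sum>l<n. M $$ (j, l) * u l) / u j"
    using Min_in[OF fin] unfolding \<sigma>_def by auto
  have "\<rho> < \<sigma>" using ustrict[OF j(1)] u[OF j(1)] j(2) by (simp add: pos_less_divide_eq)
  also have "\<sigma> \<le> spectral_radius (map_mat complex_of_real M)"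
  proof (rule spectral_radius_ge_subinvariant[OF M nonneg u])
    fix j assume j: "j < n"
    have "\<sigma> \<le> (\<Sum>l<n. M $$ (j, l) * u l) / u j" unfolding \<sigma>_def using fin j by (intro Min_le) auto
    then show "\<sigma> * u j \<le> (\<Sum>l<n. M $$ (j, l) * u l)" using u[OF j] by (simp add: pos_le_divide_eq)
  qed (use i in auto)
  finally show ?thesis .
qed

section \<open>Distances across a vertex cut\<close>

definition complete_except :: "('a, 'b) pre_digraph \<Rightarrow> 'a set \<Rightarrow> 'a set \<Rightarrow> bool" where
  "complete_except G A B \<longleftrightarrow>
     (\<forall>u\<in>verts G. \<forall>v\<in>verts G. u \<rightarrow>\<^bsub>G\<^esub> v \<longleftrightarrow> u \<noteq> v \<and> \<not> (u \<in> A \<and> v \<in> B))"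

text \<open>
  For disjoint \<open>A\<close> and \<open>B\<close>, these are the distances in a digraph that misses exactly the arcs from
  \<open>A\<close> to \<open>B\<close>, provided that some vertex lies outside both sets.
\<close>

definition split_distance :: "'a set \<Rightarrow> 'a set \<Rightarrow> 'a \<Rightarrow> 'a \<Rightarrow> nat" where
  "split_distance A B u v = (if u = v then 0 else if u \<in> A \<and> v \<in> B then 2 else 1)"

lemma shortest_apath:
  assumes "wf_digraph G" "u \<rightarrow>\<^sup>*\<^bsub>G\<^esub> v"
  obtains p where "pre_digraph.apath G u p v" "length p = dg_distance G u v"
proof -
  have "\<exists>l p. pre_digraph.apath G u p v \<and> length p = l"
    using wf_digraph.reachable_apath[OF assms(1)] assms(2) by blast
  then have "\<exists>p. pre_digraph.apath G u p v \<and> length p = dg_distance G u v"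
    unfolding dg_distance_def by (rule LeastI_ex)
  then show ?thesis using that by blast
qed

lemma dg_distance_le_apath:
  assumes "pre_digraph.apath G u p v"
  shows "dg_distance G u v \<le> length p"
  unfolding dg_distance_def by (rule Least_le) (use assms in blast)

lemma dg_distance_self:
  assumes "wf_digraph G" "u \<in> verts G"
  shows "dg_distance G u u = 0"
  using dg_distance_le_apath[of G u "[]" u] assms by (simp add: wf_digraph.apath_Nil_iff)

lemma dg_distance_arc_le:
  assumes "digraph G" "u \<rightarrow>\<^bsub>G\<^esub> v"
  shows "dg_distance G u v \<le> 1"
proof -
  interpret digraph G by fact
  obtain e where "e \<in> arcs G" "tail G e = u" "head G e = v" using assms(2) by (rule reachableE)
  then have "apath u [e] v" using no_loops[of e] by (auto simp: apath_Cons_iff apath_Nil_iff)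
  then show ?thesis using dg_distance_le_apath by fastforce
qed

lemma dg_distance_two_arcs_le:
  assumes "digraph G" "u \<rightarrow>\<^bsub>G\<^esub> s" "s \<rightarrow>\<^bsub>G\<^esub> v" "u \<noteq> v"
  shows "dg_distance G u v \<le> 2"
proof -
  interpret digraph G by fact
  obtain e where "e \<in> arcs G" "tail G e = u" "head G e = s" using assms(2) by (rule reachableE)
  moreover obtain e' where "e' \<in> arcs G" "tail G e' = s" "head G e' = v" using assms(3) by (rule reachableE)
  ultimately have "apath u [e, e'] v"
    using no_loops[of e] no_loops[of e'] assms(4) by (auto simp: apath_Cons_iff apath_Nil_iff)
  then show ?thesis using dg_distance_le_apath by fastforce
qed

lemma split_distance_le:
  assumes G: "digraph G" "strongly_connected G"
    and uv: "u \<in> verts G" "v \<in> verts G"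
    and cut: "\<And>u v. u \<in> A \<Longrightarrow> v \<in> B \<Longrightarrow> \<not> u \<rightarrow>\<^bsub>G\<^esub> v"
  shows "split_distance A B u v \<le> dg_distance G u v"
proof -
  interpret digraph G by fact
  have "u \<rightarrow>\<^sup>*\<^bsub>G\<^esub> v" using G(2) uv by (auto simp: strongly_connected_def)
  then obtain p where p: "apath u p v" "length p = dg_distance G u v"
    by (rule shortest_apath[OF wf_digraph])
  consider "p = []" | e where "p = [e]" | "length p \<ge> 2"
    by (cases p; cases "tl p") (auto simp: neq_Nil_conv Suc_le_eq)
  then show ?thesis
  proof cases
    case 1
    then show ?thesis using p by (simp add: apath_Nil_iff split_distance_def)
  next
    case 2
    then have "u \<rightarrow>\<^bsub>G\<^esub> v" using p(1) by (auto simp: apath_Cons_iff apath_Nil_iff arcs_ends_conv)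
    then show ?thesis using p(2) 2 cut by (auto simp: split_distance_def)
  next
    case 3
    then show ?thesis using p(2) by (simp add: split_distance_def)
  qed
qed

text \<open>
  The vertex \<open>s\<close> outside both sides is what keeps the distance from \<open>A\<close> to \<open>B\<close> down to \<open>2\<close>: if no
  arc other than those from \<open>A\<close> to \<open>B\<close> is missing, one can always go through \<open>s\<close>.
\<close>

lemma dg_distance_eq_split_distance_iff:
  assumes G: "digraph G" "strongly_connected G"
    and s: "s \<in> verts G" "s \<notin> A" "s \<notin> B" and disj: "A \<inter> B = {}"
    and cut: "\<And>u v. u \<in> A \<Longrightarrow> v \<in> B \<Longrightarrow> \<not> u \<rightarrow>\<^bsub>G\<^esub> v"
  shows "(\<forall>u\<in>verts G. \<forall>v\<in>verts G. dg_distance G u v = split_distance A B u v)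
    \<longleftrightarrow> complete_except G A B"
proof
  interpret digraph G by fact
  assume eq: "\<forall>u\<in>verts G. \<forall>v\<in>verts G. dg_distance G u v = split_distance A B u v"
  have "u \<rightarrow>\<^bsub>G\<^esub> v" if uv: "u \<in> verts G" "v \<in> verts G" "u \<noteq> v" "\<not> (u \<in> A \<and> v \<in> B)" for u v
  proof -
    have "u \<rightarrow>\<^sup>*\<^bsub>G\<^esub> v" using G(2) uv by (auto simp: strongly_connected_def)
    then obtain p where p: "apath u p v" "length p = dg_distance G u v"
      by (rule shortest_apath[OF wf_digraph])
    then have "length p = 1" using eq uv by (auto simp: split_distance_def)
    then obtain e where "p = [e]" by (auto simp: length_Suc_conv)
    then show ?thesis using p(1) by (auto simp: apath_Cons_iff apath_Nil_iff arcs_ends_conv)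
  qed
  then show "complete_except G A B"
    unfolding complete_except_def using cut adj_not_same by blast
next
  assume ce: "complete_except G A B"
  interpret digraph G by fact
  show "\<forall>u\<in>verts G. \<forall>v\<in>verts G. dg_distance G u v = split_distance A B u v"
  proof (intro ballI)
    fix u v assume uv: "u \<in> verts G" "v \<in> verts G"
    have "dg_distance G u v \<le> split_distance A B u v"
    proof (cases "u = v")
      case True
      then show ?thesis using uv dg_distance_self[OF wf_digraph] by simp
    next
      case False
      show ?thesis
      proof (cases "u \<in> A \<and> v \<in> B")
        case True
        then have "u \<rightarrow>\<^bsub>G\<^esub> s" "s \<rightarrow>\<^bsub>G\<^esub> v" using ce uv s unfolding complete_except_def by metis+
        then show ?thesis
          using dg_distance_two_arcs_le[OF G(1)] True False by (simp add: split_distance_def)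
      next
        case no: False
        then have "u \<rightarrow>\<^bsub>G\<^esub> v" using ce uv False unfolding complete_except_def by blast
        then show ?thesis
          using dg_distance_arc_le[OF G(1)] no False by (auto simp: split_distance_def)
      qed
    qed
    then show "dg_distance G u v = split_distance A B u v"
      using split_distance_le[OF G uv cut] by (simp add: le_antisym)
  qed
qed

text \<open>
  Delete a minimum vertex cut and take for \<open>A\<close> everything that is still reachable from a vertex \<open>u\<close>
  which no longer reaches some \<open>v\<close>; no arc can leave \<open>A\<close> except into the cut. The inequality
  \<open>k + 2 \<le> n\<close> excludes the complete digraph, whose connectivity is \<open>n - 1\<close> by convention.
\<close>

lemma vertex_cut_sides:
  assumes G: "G \<in> digraphs_with_connectivity n k" and n: "k + 2 \<le> n"
  obtains A B where "A \<subseteq> verts G" "B \<subseteq> verts G" "A \<inter> B = {}" "A \<noteq> {}" "B \<noteq> {}"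
    "card A + card B + k = n" "\<And>u v. u \<in> A \<Longrightarrow> v \<in> B \<Longrightarrow> \<not> u \<rightarrow>\<^bsub>G\<^esub> v"
proof -
  from G have dg: "digraph G" and cardV: "card (verts G) = n" and vc: "vertex_connectivity G = k"
    by (auto simp: digraphs_with_connectivity_def)
  interpret digraph G by fact
  have nc: "\<not> complete_digraph (card (verts G)) G"
    using vc cardV n unfolding vertex_connectivity_def by auto
  let ?P = "\<lambda>c. \<exists>S. S \<subseteq> verts G \<and> card S = c \<and>
    \<not> strongly_connected (induce_subgraph G (verts G - S))"
  \<comment> \<open>Deleting every vertex leaves the null graph, which is not strongly connected, so the minimum
    is attained.\<close>
  have "?P (card (verts G))"
    by (rule exI[of _ "verts G"]) (simp add: strongly_connected_def)
  then have "?P (LEAST c. ?P c)" by (rule LeastI)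
  then have "?P k" using vc nc unfolding vertex_connectivity_def by simp
  then obtain S where S: "S \<subseteq> verts G" "card S = k"
    "\<not> strongly_connected (induce_subgraph G (verts G - S))" by blast
  define H where "H = induce_subgraph G (verts G - S)"
  have VH: "verts H = verts G - S" by (simp add: H_def)
  have cardH: "card (verts H) + k = n"
    unfolding VH using S cardV n by (simp add: card_Diff_subset finite_subset)
  then have "verts H \<noteq> {}" using n by auto
  then obtain u v where uv: "u \<in> verts H" "v \<in> verts H" "\<not> u \<rightarrow>\<^sup>*\<^bsub>H\<^esub> v"
    using S(3) unfolding H_def[symmetric] strongly_connected_def by blast
  have wfH: "wf_digraph H" unfolding H_def by (rule wellformed_induce_subgraph)
  define A where "A = {x \<in> verts H. u \<rightarrow>\<^sup>*\<^bsub>H\<^esub> x}"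
  define B where "B = verts H - A"
  have finH: "finite (verts H)" by (simp add: VH)
  show ?thesis
  proof (rule that[of A B])
    show "A \<subseteq> verts G" "B \<subseteq> verts G" "A \<inter> B = {}" by (auto simp: A_def B_def VH)
    have "u \<rightarrow>\<^sup>*\<^bsub>H\<^esub> u" using uv(1) by (simp add: reachable_def)
    then show "A \<noteq> {}" "B \<noteq> {}" using uv by (auto simp: A_def B_def)
    have "A \<subseteq> verts H" by (auto simp: A_def)
    then have "card A + card B = card (verts H)"
      unfolding B_def using finH card_mono[OF finH] by (simp add: card_Diff_subset finite_subset)
    then show "card A + card B + k = n" using cardH by simp
    fix x y assume xy: "x \<in> A" "y \<in> B"
    show "\<not> x \<rightarrow>\<^bsub>G\<^esub> y"
    proof
      assume "x \<rightarrow>\<^bsub>G\<^esub> y"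
      then have "x \<rightarrow>\<^bsub>H\<^esub> y"
        using xy by (auto simp: A_def B_def VH arcs_ends_conv H_def induce_subgraph_def)
      moreover have "u \<rightarrow>\<^sup>*\<^bsub>H\<^esub> x" using xy by (simp add: A_def)
      ultimately have "u \<rightarrow>\<^sup>*\<^bsub>H\<^esub> y" using wf_digraph.reachable_adj_trans[OF wfH] by blast
      then show False using xy by (simp add: A_def B_def)
    qed
  qed
qed

section \<open>Recognising the extremal digraphs\<close>

text \<open>
  As there are no parallel arcs, the arc component of an isomorphism is determined by the vertex
  bijection.
\<close>

lemma digraph_iso_with_proj_iff:
  assumes G: "digraph G" and H: "parcs H \<subseteq> pverts H \<times> pverts H"
  shows "digraph_iso G (with_proj H) \<longleftrightarrow>
    (\<exists>f. bij_betw f (verts G) (pverts H) \<and>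
       (\<forall>u\<in>verts G. \<forall>v\<in>verts G. u \<rightarrow>\<^bsub>G\<^esub> v \<longleftrightarrow> (f u, f v) \<in> parcs H))"
proof
  interpret digraph G by fact
  assume "digraph_iso G (with_proj H)"
  then obtain h where h: "digraph_isomorphism h" "with_proj H = app_iso h G"
    unfolding digraph_iso_def by blast
  have V: "pverts H = iso_verts h ` verts G" and E: "parcs H = iso_arcs h ` arcs G"
    and t: "iso_tail h = fst" and hd: "iso_head h = snd"
    using h(2) by (metis with_proj_simps app_iso_simps)+
  have inj: "inj_on (iso_verts h) (verts G)" using h(1) by (simp add: digraph_isomorphism_def)
  have arc: "iso_arcs h e = (iso_verts h (tail G e), iso_verts h (head G e))" if "e \<in> arcs G" for e
    using iso_verts_tail[OF h(1) that] iso_verts_head[OF h(1) that] unfolding t hd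
    by (metis prod.collapse)
  show "\<exists>f. bij_betw f (verts G) (pverts H) \<and>
       (\<forall>u\<in>verts G. \<forall>v\<in>verts G. u \<rightarrow>\<^bsub>G\<^esub> v \<longleftrightarrow> (f u, f v) \<in> parcs H)"
  proof (intro exI[of _ "iso_verts h"] conjI ballI iffI)
    show "bij_betw (iso_verts h) (verts G) (pverts H)" using inj V by (simp add: bij_betw_def)
  next
    fix u v assume "u \<rightarrow>\<^bsub>G\<^esub> v"
    then obtain e where "e \<in> arcs G" "tail G e = u" "head G e = v" by (rule reachableE)
    then show "(iso_verts h u, iso_verts h v) \<in> parcs H" unfolding E using arc[of e] by force
  next
    fix u v assume uv: "u \<in> verts G" "v \<in> verts G" "(iso_verts h u, iso_verts h v) \<in> parcs H"
    then obtain e where e: "e \<in> arcs G" "iso_arcs h e = (iso_verts h u, iso_verts h v)"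
      unfolding E by auto
    then have "tail G e = u" "head G e = v"
      using arc[OF e(1)] uv inj by (auto dest: inj_onD)
    then show "u \<rightarrow>\<^bsub>G\<^esub> v" using e(1) by (auto simp: arcs_ends_conv)
  qed
next
  interpret digraph G by fact
  assume "\<exists>f. bij_betw f (verts G) (pverts H) \<and>
       (\<forall>u\<in>verts G. \<forall>v\<in>verts G. u \<rightarrow>\<^bsub>G\<^esub> v \<longleftrightarrow> (f u, f v) \<in> parcs H)"
  then obtain f where f: "bij_betw f (verts G) (pverts H)"
    and arc: "\<And>u v. u \<in> verts G \<Longrightarrow> v \<in> verts G \<Longrightarrow> u \<rightarrow>\<^bsub>G\<^esub> v \<longleftrightarrow> (f u, f v) \<in> parcs H"
    by blast
  define h where "h = \<lparr> iso_verts = f, iso_arcs = \<lambda>e. (f (tail G e), f (head G e)),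
    iso_head = snd, iso_tail = fst \<rparr>"
  have inj: "inj_on f (verts G)" using f by (simp add: bij_betw_def)
  have "inj_on (\<lambda>e. (f (tail G e), f (head G e))) (arcs G)"
  proof (rule inj_onI)
    fix e e' assume e: "e \<in> arcs G" "e' \<in> arcs G"
      and "(f (tail G e), f (head G e)) = (f (tail G e'), f (head G e'))"
    then have "tail G e = tail G e'" "head G e = head G e'" using inj by (auto dest: inj_onD)
    then show "e = e'" using e by (intro no_multi_arcs) (simp_all add: arc_to_ends_def)
  qed
  then have "digraph_isomorphism h"
    using inj wf_digraph by (simp add: digraph_isomorphism_def h_def)
  moreover have "parcs H = (\<lambda>e. (f (tail G e), f (head G e))) ` arcs G"
  proof (intro equalityI subsetI)
    fix p assume p: "p \<in> parcs H"
    then have "p \<in> f ` verts G \<times> f ` verts G" using H f unfolding bij_betw_def by blast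
    then obtain u v where uv: "u \<in> verts G" "v \<in> verts G" "p = (f u, f v)" by blast
    then have "u \<rightarrow>\<^bsub>G\<^esub> v" using arc p by simp
    then show "p \<in> (\<lambda>e. (f (tail G e), f (head G e))) ` arcs G"
      using uv(3) by (auto simp: arcs_ends_conv)
  next
    fix p assume "p \<in> (\<lambda>e. (f (tail G e), f (head G e))) ` arcs G"
    then obtain e where e: "e \<in> arcs G" "p = (f (tail G e), f (head G e))" by auto
    then have "tail G e \<rightarrow>\<^bsub>G\<^esub> head G e" by (auto simp: arcs_ends_conv)
    then show "p \<in> parcs H" using e arc[of "tail G e" "head G e"] by simp
  qed
  then have "with_proj H = app_iso h G"
    using f by (simp add: with_proj_def app_iso_def h_def bij_betw_def)
  ultimately show "digraph_iso G (with_proj H)" unfolding digraph_iso_def by blast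
qed

text \<open>
  The two parts of \<open>K(n,k,m)\<close> between which one direction is missing: no arc leads from
  \<open>K_source (n - k - m)\<close>, the vertices of the middle summand, to \<open>K_target m\<close>, those of the last.
\<close>

definition K_source :: "nat \<Rightarrow> (nat + nat + nat) set" where
  "K_source a = (Inr \<circ> Inl) ` {..<a}"

definition K_target :: "nat \<Rightarrow> (nat + nat + nat) set" where
  "K_target m = (Inr \<circ> Inr) ` {..<m}"

lemma pverts_K_digraph:
  "pverts (K_digraph n k m) = Inl ` {..<k} \<union> K_source (n - k - m) \<union> K_target m"
  by (auto simp: K_digraph_def add_arcs_dg_def join_dg_def disjoint_union_dg_def complete_dg_def
      K_source_def K_target_def)

lemma parcs_K_digraph:
  "(p, q) \<in> parcs (K_digraph n k m) \<longleftrightarrow>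
     p \<in> pverts (K_digraph n k m) \<and> q \<in> pverts (K_digraph n k m) \<and> p \<noteq> q \<and>
     \<not> (p \<in> K_source (n - k - m) \<and> q \<in> K_target m)"
proof -
  have [simp]: "(x, y) \<in> map_prod f g ` R \<longleftrightarrow> (\<exists>a b. (a, b) \<in> R \<and> x = f a \<and> y = g b)"
    for x y R and f :: "'x \<Rightarrow> 'y" and g :: "'z \<Rightarrow> 'w" by auto
  show ?thesis
    by (cases p; cases q; (cases "projr p")?; (cases "projr q")?)
      (auto simp: pverts_K_digraph K_digraph_def add_arcs_dg_def join_dg_def disjoint_union_dg_def
        complete_dg_def K_source_def K_target_def)
qed

text \<open>
  This turns isomorphism with \<open>K(n,k,m)\<close> into a property of \<open>G\<close> itself, so that no distances or
  matrices of \<open>K(n,k,m)\<close> have to be computed. The join part \<open>K\<^sub>k\<close> is the complement of \<open>A \<union> B\<close>.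
\<close>

lemma digraph_iso_K_digraph_iff:
  assumes G: "digraph G" and n: "card (verts G) = n" and m: "k + m \<le> n"
  shows "digraph_iso G (with_proj (K_digraph n k m)) \<longleftrightarrow>
    (\<exists>A B. A \<subseteq> verts G \<and> B \<subseteq> verts G \<and> A \<inter> B = {} \<and> card A = n - k - m \<and> card B = m \<and>
       complete_except G A B)" (is "_ \<longleftrightarrow> ?R")
proof -
  interpret digraph G by fact
  let ?K = "K_digraph n k m" and ?A = "K_source (n - k - m)" and ?B = "K_target m"
  have sub: "parcs ?K \<subseteq> pverts ?K \<times> pverts ?K" using parcs_K_digraph by auto
  have K: "?A \<subseteq> pverts ?K" "?B \<subseteq> pverts ?K" "?A \<inter> ?B = {}" "card ?A = n - k - m" "card ?B = m"
    by (auto simp: pverts_K_digraph K_source_def K_target_def card_image inj_on_def)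
  show ?thesis
    unfolding digraph_iso_with_proj_iff[OF G sub]
  proof
    assume "\<exists>f. bij_betw f (verts G) (pverts ?K) \<and>
       (\<forall>u\<in>verts G. \<forall>v\<in>verts G. u \<rightarrow>\<^bsub>G\<^esub> v \<longleftrightarrow> (f u, f v) \<in> parcs ?K)"
    then obtain f where f: "bij_betw f (verts G) (pverts ?K)"
      and arc: "\<And>u v. u \<in> verts G \<Longrightarrow> v \<in> verts G \<Longrightarrow> u \<rightarrow>\<^bsub>G\<^esub> v \<longleftrightarrow> (f u, f v) \<in> parcs ?K"
      by blast
    have inj: "inj_on f (verts G)" and im: "f ` verts G = pverts ?K" using f by (simp_all add: bij_betw_def)
    define A where "A = {u \<in> verts G. f u \<in> ?A}"
    define B where "B = {u \<in> verts G. f u \<in> ?B}"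
    have "f ` A = f ` verts G \<inter> ?A" "f ` B = f ` verts G \<inter> ?B" by (auto simp: A_def B_def)
    then have "f ` A = ?A" "f ` B = ?B" using K(1,2) im by auto
    moreover have "inj_on f A" "inj_on f B"
      using inj by (auto simp: A_def B_def intro: inj_on_subset)
    ultimately have cards: "card A = n - k - m" "card B = m"
      using K(4,5) card_image[of f A] card_image[of f B] by simp_all
    have "complete_except G A B"
      unfolding complete_except_def
    proof (intro ballI)
      fix u v assume uv: "u \<in> verts G" "v \<in> verts G"
      then have "f u \<in> pverts ?K" "f v \<in> pverts ?K" using im by auto
      then show "u \<rightarrow>\<^bsub>G\<^esub> v \<longleftrightarrow> u \<noteq> v \<and> \<not> (u \<in> A \<and> v \<in> B)"
        using uv inj_on_eq_iff[OF inj uv] unfolding arc[OF uv] parcs_K_digraph A_def B_def by simp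
    qed
    moreover have "A \<subseteq> verts G" "B \<subseteq> verts G" "A \<inter> B = {}" using K(3) by (auto simp: A_def B_def)
    ultimately show ?R using cards by blast
  next
    assume ?R
    then obtain A B where AB: "A \<subseteq> verts G" "B \<subseteq> verts G" "A \<inter> B = {}"
      "card A = n - k - m" "card B = m" "complete_except G A B" by blast
    define S where "S = verts G - (A \<union> B)"
    have fin: "finite A" "finite B" "finite S" using AB by (auto simp: S_def intro: finite_subset)
    have "card (A \<union> B) = n - k" using AB fin m by (simp add: card_Un_disjoint)
    then have "card S = k" unfolding S_def using AB fin n m by (simp add: card_Diff_subset)
    moreover have "card (Inl ` {..<k} :: (nat + nat + nat) set) = k" by (simp add: card_image)
    ultimately obtain fs where fs: "bij_betw fs S (Inl ` {..<k} :: (nat + nat + nat) set)"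
      using finite_same_card_bij[OF fin(3), of "Inl ` {..<k} :: (nat + nat + nat) set"] by auto
    have finK: "finite ?A" "finite ?B" by (simp_all add: K_source_def K_target_def)
    obtain fa where fa: "bij_betw fa A ?A"
      using finite_same_card_bij[OF fin(1) finK(1)] AB(4) K(4) by auto
    obtain fb where fb: "bij_betw fb B ?B"
      using finite_same_card_bij[OF fin(2) finK(2)] AB(5) K(5) by auto
    define f where "f u = (if u \<in> A then fa u else if u \<in> B then fb u else fs u)" for u
    have bA: "bij_betw f A ?A" using fa by (subst bij_betw_cong[of A f fa]) (auto simp: f_def)
    have bB: "bij_betw f B ?B"
      using fb AB(3) by (subst bij_betw_cong[of B f fb]) (auto simp: f_def)
    have bS: "bij_betw f S (Inl ` {..<k})"
      using fs by (subst bij_betw_cong[of S f fs]) (auto simp: f_def S_def)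
    have disj: "Inl ` {..<k} \<inter> ?A = {}" "(Inl ` {..<k} \<union> ?A) \<inter> ?B = {}"
      by (auto simp: K_source_def K_target_def)
    have "bij_betw f (S \<union> A \<union> B) (Inl ` {..<k} \<union> ?A \<union> ?B)"
      by (rule bij_betw_combine[OF bij_betw_combine[OF bS bA disj(1)] bB disj(2)])
    moreover have "S \<union> A \<union> B = verts G" using AB by (auto simp: S_def)
    ultimately have f: "bij_betw f (verts G) (pverts ?K)" by (simp add: pverts_K_digraph)
    have inj: "inj_on f (verts G)" using f by (simp add: bij_betw_def)
    have inA: "f u \<in> ?A \<longleftrightarrow> u \<in> A" and inB: "f u \<in> ?B \<longleftrightarrow> u \<in> B" if "u \<in> verts G" for u
      using inj_on_image_mem_iff[OF inj that] AB(1,2) bA bB unfolding bij_betw_def by metis+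
    have "u \<rightarrow>\<^bsub>G\<^esub> v \<longleftrightarrow> (f u, f v) \<in> parcs ?K" if uv: "u \<in> verts G" "v \<in> verts G" for u v
    proof -
      have "f u \<in> pverts ?K" "f v \<in> pverts ?K" "f u = f v \<longleftrightarrow> u = v"
        using bij_betwE[OF f] uv inj_on_eq_iff[OF inj uv] by auto
      then show ?thesis
        using AB(6) uv unfolding complete_except_def parcs_K_digraph inA[OF uv(1)] inB[OF uv(2)] by blast
    qed
    then show "\<exists>f. bij_betw f (verts G) (pverts ?K) \<and>
       (\<forall>u\<in>verts G. \<forall>v\<in>verts G. u \<rightarrow>\<^bsub>G\<^esub> v \<longleftrightarrow> (f u, f v) \<in> parcs ?K)"
      using f by blast
  qed
qed

section \<open>The spectral radius of digraphs with a one-way cut\<close>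

text \<open>
  Row \<open>u\<close> of \<open>D\<^sub>\<alpha>\<close> applied to \<open>w\<close> is \<open>\<Sum>v. d(u,v) (\<alpha> w(u) + (1 - \<alpha>) w(v))\<close>, because the
  transmission is itself a sum of distances. In this form the enumeration \<open>vs\<close> disappears and the
  row is monotone in the distances.
\<close>

lemma mu_alpha_subinvariant:
  fixes G :: "('a, 'b) pre_digraph" and w :: "'a \<Rightarrow> real" and \<alpha> \<rho> :: real
  assumes vs: "distinct vs" "set vs = verts G" "vs \<noteq> []"
    and \<alpha>: "0 \<le> \<alpha>" "\<alpha> < 1"
    and dist: "\<And>u v. u \<in> verts G \<Longrightarrow> v \<in> verts G \<Longrightarrow> u \<noteq> v \<Longrightarrow> dg_distance G u v > 0"
      "\<And>u. u \<in> verts G \<Longrightarrow> dg_distance G u u = 0"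
    and w: "\<And>u. u \<in> verts G \<Longrightarrow> w u > 0"
    and sub: "\<And>u. u \<in> verts G \<Longrightarrow>
      \<rho> * w u \<le> (\<Sum>v\<in>verts G. dg_distance G u v * (\<alpha> * w u + (1 - \<alpha>) * w v))"
  shows "\<rho> \<le> mu_alpha \<alpha> G vs"
    and "mu_alpha \<alpha> G vs = \<rho> \<longleftrightarrow>
      (\<forall>u\<in>verts G. (\<Sum>v\<in>verts G. dg_distance G u v * (\<alpha> * w u + (1 - \<alpha>) * w v)) = \<rho> * w u)"
proof -
  define n where "n = length vs"
  define M where "M = D_alpha \<alpha> G vs"
  define row where "row u = (\<Sum>v\<in>verts G. dg_distance G u v * (\<alpha> * w u + (1 - \<alpha>) * w v))" for u
  have M: "M \<in> carrier_mat n n"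
    by (simp add: M_def D_alpha_def transmission_matrix_def distance_matrix_def n_def)
  have entry: "M $$ (i, j) = (if i = j then \<alpha> * transmission G (vs ! i) else 0)
      + (1 - \<alpha>) * dg_distance G (vs ! i) (vs ! j)" if "i < n" "j < n" for i j
    using that by (simp add: M_def D_alpha_def transmission_matrix_def distance_matrix_def n_def)
  have V: "vs ! i \<in> verts G" if "i < n" for i
    using nth_mem[of i vs] that unfolding vs(2) n_def by blast
  have nonneg: "M $$ (i, j) \<ge> 0" if "i < n" "j < n" for i j
    using that \<alpha> by (simp add: entry)
  have pos: "M $$ (i, j) > 0" if "i < n" "j < n" "i \<noteq> j" for i j
  proof -
    have "vs ! i \<noteq> vs ! j" using that vs(1) by (simp add: n_def nth_eq_iff_index_eq)
    then show ?thesis using that \<alpha> dist(1) V by (simp add: entry)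
  qed
  have bij: "bij_betw ((!) vs) {..<n} (verts G)"
    using bij_betw_nth[OF vs(1), of "{..<n}" "verts G"] vs(2) by (simp add: n_def)
  have row: "(\<Sum>j<n. M $$ (i, j) * w (vs ! j)) = row (vs ! i)" if i: "i < n" for i
  proof -
    have "(\<Sum>j<n. M $$ (i, j) * w (vs ! j))
      = (\<Sum>j<n. (if j = i then \<alpha> * transmission G (vs ! i) * w (vs ! i) else 0)
          + (1 - \<alpha>) * dg_distance G (vs ! i) (vs ! j) * w (vs ! j))"
      using i by (intro sum.cong) (auto simp: entry algebra_simps)
    also have "\<dots> = \<alpha> * transmission G (vs ! i) * w (vs ! i)
      + (\<Sum>j<n. (1 - \<alpha>) * dg_distance G (vs ! i) (vs ! j) * w (vs ! j))"
      using i by (simp add: sum.distrib)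
    also have "(\<Sum>j<n. (1 - \<alpha>) * dg_distance G (vs ! i) (vs ! j) * w (vs ! j))
      = (\<Sum>v\<in>verts G. (1 - \<alpha>) * dg_distance G (vs ! i) v * w v)"
      using sum.reindex_bij_betw[OF bij, of "\<lambda>v. (1 - \<alpha>) * dg_distance G (vs ! i) v * w v"] .
    also have "\<alpha> * transmission G (vs ! i) * w (vs ! i)
      = (\<Sum>v\<in>verts G. \<alpha> * dg_distance G (vs ! i) v * w (vs ! i))"
      by (simp add: transmission_def sum_distrib_left sum_distrib_right)
    finally show ?thesis unfolding row_def by (simp add: algebra_simps sum.distrib sum_subtractf)
  qed
  have "n \<noteq> 0" using vs(3) by (simp add: n_def)
  have mu: "mu_alpha \<alpha> G vs = spectral_radius (map_mat complex_of_real M)"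
    by (simp add: mu_alpha_def M_def)
  have wpos: "w (vs ! i) > 0" if "i < n" for i using w V that by simp
  have subM: "\<rho> * w (vs ! i) \<le> (\<Sum>j<n. M $$ (i, j) * w (vs ! j))" if "i < n" for i
    using sub[OF V[OF that]] unfolding row[OF that] row_def .
  show "\<rho> \<le> mu_alpha \<alpha> G vs"
    unfolding mu by (rule spectral_radius_ge_subinvariant[OF M nonneg wpos \<open>n \<noteq> 0\<close> subM])
  have "mu_alpha \<alpha> G vs = \<rho> \<longleftrightarrow> (\<forall>u\<in>verts G. row u = \<rho> * w u)"
  proof
    assume eq: "mu_alpha \<alpha> G vs = \<rho>"
    show "\<forall>u\<in>verts G. row u = \<rho> * w u"
    proof (rule ccontr)
      assume "\<not> (\<forall>u\<in>verts G. row u = \<rho> * w u)"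
      then obtain u where "u \<in> verts G" "row u \<noteq> \<rho> * w u" by blast
      then obtain i where i: "i < n" "row (vs ! i) \<noteq> \<rho> * w (vs ! i)"
        using vs(2) in_set_conv_nth[of u vs] by (auto simp: n_def)
      then have "\<rho> * w (vs ! i) < (\<Sum>j<n. M $$ (i, j) * w (vs ! j))"
        using subM[OF i(1)] row[OF i(1)] by simp
      then have "\<rho> < spectral_radius (map_mat complex_of_real M)"
        using spectral_radius_gt_subinvariant[OF M nonneg pos wpos subM i(1)] by blast
      then show False using eq mu by simp
    qed
  next
    assume "\<forall>u\<in>verts G. row u = \<rho> * w u"
    then have eig: "(\<Sum>j<n. M $$ (i, j) * w (vs ! j)) = \<rho> * w (vs ! i)" if "i < n" for i
      using V[OF that] row[OF that] by simp
    show "mu_alpha \<alpha> G vs = \<rho>"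
      unfolding mu by (rule spectral_radius_eq_positive_eigenvector[OF M nonneg wpos \<open>n \<noteq> 0\<close> eig])
  qed
  then show "mu_alpha \<alpha> G vs = \<rho> \<longleftrightarrow>
      (\<forall>u\<in>verts G. (\<Sum>v\<in>verts G. dg_distance G u v * (\<alpha> * w u + (1 - \<alpha>) * w v)) = \<rho> * w u)"
    unfolding row_def .
qed

lemma split_distance_row_sum:
  fixes w :: "'a \<Rightarrow> real" and \<alpha> \<beta> x y :: real
  assumes V: "finite V" "A \<subseteq> V" "B \<subseteq> V" "A \<inter> B = {}" and u: "u \<in> V"
    and w: "\<And>v. w v = (if v \<in> A then x else y)"
  shows "(\<Sum>v\<in>V. split_distance A B u v * (\<alpha> * w u + \<beta> * w v))
    = \<alpha> * w u * (real (card V) - 1) + \<beta> * (card A * x + (real (card V) - card A) * y - w u)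
      + (if u \<in> A then card B * (\<alpha> * x + \<beta> * y) else 0)"
proof -
  let ?c = "\<lambda>v. \<alpha> * w u + \<beta> * w v"
  have "(\<Sum>v\<in>V. split_distance A B u v * ?c v)
    = (\<Sum>v\<in>V. ?c v - (if v = u then ?c u else 0) + (if v \<in> B then if u \<in> A then ?c v else 0 else 0))"
    using V(4) by (intro sum.cong) (auto simp: split_distance_def)
  also have "\<dots> = (\<Sum>v\<in>V. ?c v) - ?c u + (\<Sum>v\<in>B. if u \<in> A then ?c v else 0)"
  proof -
    have "(\<Sum>v\<in>V. if v \<in> B then if u \<in> A then ?c v else 0 else 0) = (\<Sum>v\<in>B. if u \<in> A then ?c v else 0)"
      using V by (simp add: sum.If_cases Int_absorb1)
    then show ?thesis using V(1) u by (simp only: sum.distrib sum_subtractf) simp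
  qed
  also have "(\<Sum>v\<in>B. if u \<in> A then ?c v else 0) = (if u \<in> A then card B * (\<alpha> * x + \<beta> * y) else 0)"
  proof -
    have "w v = y" if "v \<in> B" for v using that V(4) w by auto
    then show ?thesis using w by simp
  qed
  also have "(\<Sum>v\<in>V. ?c v) = \<alpha> * w u * card V + \<beta> * (\<Sum>v\<in>V. w v)"
    by (simp add: sum.distrib sum_distrib_left)
  also have "(\<Sum>v\<in>V. w v) = card A * x + (real (card V) - card A) * y"
  proof -
    have "(\<Sum>v\<in>V. w v) = card A * x + card (V - A) * y"
      using V(1,2) by (simp add: w sum.If_cases Int_absorb1 Diff_eq)
    then show ?thesis
      using V(1,2) by (simp add: card_Diff_subset finite_subset of_nat_diff card_mono)
  qed
  finally show ?thesis
    by (simp add: algebra_simps)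
qed

text \<open>
  The vector with value \<open>(1 - \<alpha>) |A| + t\<close> on \<open>A\<close> and \<open>(1 - \<alpha>) |A|\<close> elsewhere is chosen so that the
  rows outside \<open>A\<close> have the eigenvalue \<open>\<rho> = |V| - 1 + t\<close> whatever \<open>t\<close> is. A row in \<open>A\<close> exceeds
  \<open>\<rho> w(u)\<close> by \<open>m (\<alpha> t + (1 - \<alpha>) |A|) - t\<^sup>2 - (1 - \<alpha>) |V| t\<close> with \<open>m = |B|\<close>. The assumed equation
  for \<open>t\<close> says that this vanishes for \<open>m = 1\<close>, \<open>|A| = |V| - k - 1\<close>; since \<open>m + |A|\<close> is
  fixed, the excess for general \<open>m\<close> factors as stated.
\<close>

lemma split_distance_row_sum_excess:
  fixes w :: "'a \<Rightarrow> real" and \<alpha> t :: real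
  assumes V: "finite V" "A \<subseteq> V" "B \<subseteq> V" "A \<inter> B = {}" and u: "u \<in> V"
    and card: "card A + card B + k = card V"
    and root: "t^2 + ((1 - \<alpha>) * card V - \<alpha>) * t = (1 - \<alpha>) * (real (card V) - k - 1)"
    and w: "\<And>v. w v = (1 - \<alpha>) * card A + (if v \<in> A then t else 0)"
  shows "(\<Sum>v\<in>V. split_distance A B u v * (\<alpha> * w u + (1 - \<alpha>) * w v))
    = (real (card V) - 1 + t) * w u
      + (if u \<in> A then (real (card B) - 1) * (\<alpha> * t + (1 - \<alpha>) * (real (card A) - 1)) else 0)"
proof -
  define a m N \<beta> :: real
    where abb: "a = real (card A)" "m = real (card B)" "N = real (card V)" "\<beta> = 1 - \<alpha>"
  have k: "real k = N - a - m" using arg_cong[OF card, of real] by (simp add: abb(1-3))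
  have w': "w v = (if v \<in> A then t + \<beta> * a else \<beta> * a)" for v by (simp add: w abb)
  have \<alpha>: "\<alpha> = 1 - \<beta>" by (simp add: abb)
  have sum: "(\<Sum>v\<in>V. split_distance A B u v * (\<alpha> * w u + (1 - \<alpha>) * w v))
    = \<alpha> * w u * (N - 1) + \<beta> * (a * (t + \<beta> * a) + (N - a) * (\<beta> * a) - w u)
      + (if u \<in> A then m * (\<alpha> * (t + \<beta> * a) + \<beta> * (\<beta> * a)) else 0)"
    using split_distance_row_sum[OF V u w', of \<alpha> \<beta>] by (simp add: abb)
  have t2: "t^2 = \<beta> * (a + m - 1) - (\<beta> * N - \<alpha>) * t"
    using root unfolding k abb(3)[symmetric] abb(4)[symmetric] by (simp add: algebra_simps)
  show ?thesis
  proof (cases "u \<in> A")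
    case False
    then show ?thesis unfolding sum abb(1-3)[symmetric] by (simp add: w' \<alpha> algebra_simps)
  next
    case True
    then have wu: "w u = t + \<beta> * a" by (simp add: w')
    have "(N - 1 + t) * w u + (m - 1) * (\<alpha> * t + \<beta> * (a - 1))
      = t^2 + (N - 1 + \<beta> * a) * t + (N - 1) * (\<beta> * a) + (m - 1) * (\<alpha> * t + \<beta> * (a - 1))"
      unfolding wu by (simp add: algebra_simps power2_eq_square)
    also have "\<dots> = \<alpha> * w u * (N - 1) + \<beta> * (a * (t + \<beta> * a) + (N - a) * (\<beta> * a) - w u)
      + m * (\<alpha> * (t + \<beta> * a) + \<beta> * (\<beta> * a))"
      unfolding t2 wu \<alpha> by (simp add: algebra_simps power2_eq_square)
    finally show ?thesis using True unfolding sum unfolding abb[symmetric] by simp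
  qed
qed

text \<open>
  The excess \<open>(|B| - 1) (\<alpha> t + (1 - \<alpha>) (|A| - 1))\<close> is where the two parts of the theorem separate:
  its second factor is positive if \<open>\<alpha> > 0\<close>, while for \<open>\<alpha> = 0\<close> it vanishes at \<open>|A| = 1\<close>.
\<close>

lemma mu_alpha_one_way_cut:
  fixes G :: "('a, 'b) pre_digraph" and \<alpha> t :: real
  assumes G: "digraph G" "strongly_connected G"
    and vs: "distinct vs" "set vs = verts G"
    and \<alpha>: "0 \<le> \<alpha>" "\<alpha> < 1"
    and AB: "A \<subseteq> verts G" "B \<subseteq> verts G" "A \<inter> B = {}" "A \<noteq> {}" "B \<noteq> {}"
    and card: "card A + card B + k = card (verts G)" and "0 < k"
    and cut: "\<And>u v. u \<in> A \<Longrightarrow> v \<in> B \<Longrightarrow> \<not> u \<rightarrow>\<^bsub>G\<^esub> v"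
    and root: "t^2 + ((1 - \<alpha>) * card (verts G) - \<alpha>) * t = (1 - \<alpha>) * (real (card (verts G)) - k - 1)"
    and t: "t > 0"
  shows "real (card (verts G)) - 1 + t \<le> mu_alpha \<alpha> G vs"
    and "mu_alpha \<alpha> G vs = real (card (verts G)) - 1 + t \<longleftrightarrow>
      complete_except G A B \<and> (card B = 1 \<or> \<alpha> = 0 \<and> card A = 1)"
proof -
  interpret digraph G by fact
  let ?V = "verts G" and ?\<rho> = "real (card (verts G)) - 1 + t"
  define w where "w v = (1 - \<alpha>) * card A + (if v \<in> A then t else 0)" for v
  define excess where "excess = (real (card B) - 1) * (\<alpha> * t + (1 - \<alpha>) * (real (card A) - 1))"
  let ?c = "\<lambda>u v. \<alpha> * w u + (1 - \<alpha>) * w v"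
  have fin: "finite A" "finite B" using AB by (auto intro: finite_subset)
  have cA: "card A \<ge> 1" and cB: "card B \<ge> 1"
    using AB fin by (simp_all add: Suc_le_eq card_gt_0_iff)
  have w: "w v > 0" for v using \<alpha> t cA by (auto simp: w_def intro!: add_pos_nonneg)
  have c: "?c u v > 0" for u v using \<alpha> w[of u] w[of v] by (intro add_nonneg_pos) auto
  have excess: "excess \<ge> 0"
    unfolding excess_def using \<alpha> t cA cB by (intro mult_nonneg_nonneg add_nonneg_nonneg) auto
  have excess0: "excess = 0 \<longleftrightarrow> card B = 1 \<or> \<alpha> = 0 \<and> card A = 1"
  proof -
    have "\<alpha> * t + (1 - \<alpha>) * (real (card A) - 1) = 0 \<longleftrightarrow> \<alpha> = 0 \<and> card A = 1"
      using \<alpha> t cA by (subst add_nonneg_eq_0_iff) auto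
    then show ?thesis by (auto simp: excess_def)
  qed
  have split: "(\<Sum>v\<in>?V. split_distance A B u v * ?c u v) = ?\<rho> * w u + (if u \<in> A then excess else 0)"
    if "u \<in> ?V" for u
    using split_distance_row_sum_excess[OF finite_verts AB(1-3) that card root w_def]
    by (simp add: excess_def)
  have le: "split_distance A B u v \<le> dg_distance G u v" if "u \<in> ?V" "v \<in> ?V" for u v
    using split_distance_le[OF G that cut] .
  have term_le: "split_distance A B u v * ?c u v \<le> dg_distance G u v * ?c u v"
    if "u \<in> ?V" "v \<in> ?V" for u v
    using le[OF that] c[of u v] by (intro mult_right_mono) auto
  have row_le: "?\<rho> * w u + (if u \<in> A then excess else 0) \<le> (\<Sum>v\<in>?V. dg_distance G u v * ?c u v)"
    if "u \<in> ?V" for u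
    unfolding split[OF that, symmetric] by (intro sum_mono term_le that)
  have row_eq: "(\<Sum>v\<in>?V. dg_distance G u v * ?c u v) = ?\<rho> * w u \<longleftrightarrow>
      (u \<in> A \<longrightarrow> excess = 0) \<and> (\<forall>v\<in>?V. dg_distance G u v = split_distance A B u v)"
    if u: "u \<in> ?V" for u
  proof
    assume eq: "(\<Sum>v\<in>?V. dg_distance G u v * ?c u v) = ?\<rho> * w u"
    then have e: "u \<in> A \<longrightarrow> excess = 0" using row_le[OF u] excess by auto
    then have "(\<Sum>v\<in>?V. dg_distance G u v * ?c u v - split_distance A B u v * ?c u v) = 0"
      unfolding sum_subtractf split[OF u] eq by auto
    then have "\<forall>v\<in>?V. dg_distance G u v * ?c u v - split_distance A B u v * ?c u v = 0"
      using term_le[OF u] by (subst (asm) sum_nonneg_eq_0_iff) auto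
    moreover have "?c u v \<noteq> 0" for v using c[of u v] by linarith
    ultimately show "(u \<in> A \<longrightarrow> excess = 0) \<and> (\<forall>v\<in>?V. dg_distance G u v = split_distance A B u v)"
      using e by (simp flip: left_diff_distrib)
  next
    assume "(u \<in> A \<longrightarrow> excess = 0) \<and> (\<forall>v\<in>?V. dg_distance G u v = split_distance A B u v)"
    then show "(\<Sum>v\<in>?V. dg_distance G u v * ?c u v) = ?\<rho> * w u"
      using split[OF u] by (simp split: if_splits)
  qed
  have ne: "vs \<noteq> []" using vs(2) AB by auto
  have dpos: "dg_distance G u v > 0" if "u \<in> ?V" "v \<in> ?V" "u \<noteq> v" for u v
    using le[OF that(1,2)] that(3) by (auto simp: split_distance_def split: if_splits)
  have d0: "dg_distance G u u = 0" if "u \<in> ?V" for u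
    using dg_distance_self[OF wf_digraph that] .
  have sub: "?\<rho> * w u \<le> (\<Sum>v\<in>?V. dg_distance G u v * ?c u v)" if "u \<in> ?V" for u
    using row_le[OF that] excess by (auto split: if_splits)
  note mu = mu_alpha_subinvariant[OF vs ne \<alpha> dpos d0 w sub]
  show "?\<rho> \<le> mu_alpha \<alpha> G vs" by (rule mu(1))
  have "card (A \<union> B) < card ?V" using card \<open>0 < k\<close> fin AB(3) by (simp add: card_Un_disjoint)
  then have "\<not> ?V \<subseteq> A \<union> B" using fin by (meson card_mono finite_UnI not_le)
  then obtain s where s: "s \<in> ?V" "s \<notin> A" "s \<notin> B" by blast
  have "mu_alpha \<alpha> G vs = ?\<rho> \<longleftrightarrow>
      (\<forall>u\<in>?V. (u \<in> A \<longrightarrow> excess = 0) \<and> (\<forall>v\<in>?V. dg_distance G u v = split_distance A B u v))"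
    using mu(2) row_eq by simp
  also have "\<dots> \<longleftrightarrow> excess = 0 \<and> (\<forall>u\<in>?V. \<forall>v\<in>?V. dg_distance G u v = split_distance A B u v)"
    using AB(1,4) by blast
  also have "\<dots> \<longleftrightarrow> complete_except G A B \<and> (card B = 1 \<or> \<alpha> = 0 \<and> card A = 1)"
    using excess0 dg_distance_eq_split_distance_iff[OF G s AB(3)] cut by blast
  finally show "mu_alpha \<alpha> G vs = ?\<rho> \<longleftrightarrow>
      complete_except G A B \<and> (card B = 1 \<or> \<alpha> = 0 \<and> card A = 1)" .
qed

text \<open>
  The preceding lemma is used twice: with the sides of a minimum cut, for the bound and for what
  equality implies, and with the sides carried over from an isomorphism with \<open>K(n,k,m)\<close>, for the
  converse.
\<close>

lemma connectivity_mu_alpha_bound: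
  fixes G :: "('a, 'b) pre_digraph" and \<alpha> t :: real
  assumes k: "0 < k" and n: "k + 2 \<le> n" and G: "G \<in> digraphs_with_connectivity n k"
    and vs: "distinct vs" "set vs = verts G"
    and \<alpha>: "0 \<le> \<alpha>" "\<alpha> < 1"
    and root: "t^2 + ((1 - \<alpha>) * n - \<alpha>) * t = (1 - \<alpha>) * (real n - k - 1)" and t: "t > 0"
  shows "real n - 1 + t \<le> mu_alpha \<alpha> G vs"
    and "mu_alpha \<alpha> G vs = real n - 1 + t \<longleftrightarrow>
      \<alpha> = 0 \<and> digraph_iso G (with_proj (K_digraph n k (n - k - 1))) \<or>
      digraph_iso G (with_proj (K_digraph n k 1))"
proof -
  from G have dg: "digraph G" "strongly_connected G" and V: "card (verts G) = n"
    by (auto simp: digraphs_with_connectivity_def)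
  note cut_bound = mu_alpha_one_way_cut[OF dg vs \<alpha>, unfolded V, OF _ _ _ _ _ _ k _ root t]
  obtain A B where AB: "A \<subseteq> verts G" "B \<subseteq> verts G" "A \<inter> B = {}" "A \<noteq> {}" "B \<noteq> {}"
    "card A + card B + k = n" "\<And>u v. u \<in> A \<Longrightarrow> v \<in> B \<Longrightarrow> \<not> u \<rightarrow>\<^bsub>G\<^esub> v"
    using vertex_cut_sides[OF G n] by blast
  note iso = digraph_iso_K_digraph_iff[OF dg(1) V]
  show "real n - 1 + t \<le> mu_alpha \<alpha> G vs" by (rule cut_bound(1)[OF AB])
  show "mu_alpha \<alpha> G vs = real n - 1 + t \<longleftrightarrow>
      \<alpha> = 0 \<and> digraph_iso G (with_proj (K_digraph n k (n - k - 1))) \<or>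
      digraph_iso G (with_proj (K_digraph n k 1))"
  proof
    assume "mu_alpha \<alpha> G vs = real n - 1 + t"
    then have ce: "complete_except G A B" and card: "card B = 1 \<or> \<alpha> = 0 \<and> card A = 1"
      using cut_bound(2)[OF AB] by auto
    have "digraph_iso G (with_proj (K_digraph n k (card B)))"
    proof -
      have "card A = n - k - card B" "k + card B \<le> n" using AB(6) by simp_all
      then show ?thesis using iso[of k "card B"] AB(1-3) ce by blast
    qed
    moreover have "card A = 1 \<Longrightarrow> card B = n - k - 1" using AB(6) by simp
    ultimately show "\<alpha> = 0 \<and> digraph_iso G (with_proj (K_digraph n k (n - k - 1))) \<or>
      digraph_iso G (with_proj (K_digraph n k 1))" using card by auto
  next
    assume "\<alpha> = 0 \<and> digraph_iso G (with_proj (K_digraph n k (n - k - 1))) \<or>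
      digraph_iso G (with_proj (K_digraph n k 1))"
    then obtain m where m: "m = 1 \<or> \<alpha> = 0 \<and> m = n - k - 1"
      and iso_m: "digraph_iso G (with_proj (K_digraph n k m))" by blast
    have m_le: "1 \<le> m" "k + m + 1 \<le> n" using m n by auto
    then obtain A' B' where AB': "A' \<subseteq> verts G" "B' \<subseteq> verts G" "A' \<inter> B' = {}"
      "card A' = n - k - m" "card B' = m" and ce: "complete_except G A' B'"
      using iso_m iso[of k m] by auto
    have "A' \<noteq> {}" "B' \<noteq> {}" "card A' + card B' + k = n" using AB' m_le by auto
    moreover have "\<not> u \<rightarrow>\<^bsub>G\<^esub> v" if "u \<in> A'" "v \<in> B'" for u v
      using that ce AB' unfolding complete_except_def by blast
    moreover have "card B' = 1 \<or> \<alpha> = 0 \<and> card A' = 1" using m m_le AB' by auto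
    ultimately show "mu_alpha \<alpha> G vs = real n - 1 + t"
      using cut_bound(2)[OF AB'(1-3)] ce by blast
  qed
qed

lemma positive_root_quadratic:
  fixes b c :: real
  assumes "c > 0"
  defines "t \<equiv> (sqrt (b^2 + 4 * c) - b) / 2"
  shows "t > 0" and "t^2 + b * t = c"
proof -
  have "b \<le> sqrt (b^2)" by simp
  also have "\<dots> < sqrt (b^2 + 4 * c)" by (rule real_sqrt_less_mono) (use assms(1) in simp)
  finally show "t > 0" by (simp add: t_def)
  have "(sqrt (b^2 + 4 * c))^2 = b^2 + 4 * c" using assms(1) by simp
  then show "t^2 + b * t = c" by (simp add: t_def power2_eq_square field_simps)
qed

theorem theorem4p6:
  fixes G :: "('a, 'b) pre_digraph" and vs :: "'a list" and n k :: nat and \<alpha> :: real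
  assumes "0 < n" and "0 < k" and "n \<ge> 2 * k + 2"
    and "G \<in> digraphs_with_connectivity n k"
    and "distinct vs" and "set vs = verts G"
  shows
    "(\<alpha> = 0 \<longrightarrow>
       mu_alpha \<alpha> G vs \<ge> (real n - 2 + sqrt (real n ^ 2 + 4 * real n - 4 * real k - 4)) / 2 \<and>
       (mu_alpha \<alpha> G vs = (real n - 2 + sqrt (real n ^ 2 + 4 * real n - 4 * real k - 4)) / 2 \<longleftrightarrow>
          digraph_iso G (with_proj (K_digraph n k (n - k - 1))) \<or>
          digraph_iso G (with_proj (K_digraph n k 1)))) \<and>
     (0 < \<alpha> \<and> \<alpha> < 1 \<longrightarrow>
       mu_alpha \<alpha> G vs \<ge>
         (real n - 2 + \<alpha> + \<alpha> * real n +
           sqrt ((1 - \<alpha>) ^ 2 * real n ^ 2 + (2 * \<alpha> ^ 2 - 6 * \<alpha> + 4) * real n +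
                 (\<alpha> ^ 2 + 4 * \<alpha> - 4) - 4 * (1 - \<alpha>) * real k)) / 2 \<and>
       (mu_alpha \<alpha> G vs =
         (real n - 2 + \<alpha> + \<alpha> * real n +
           sqrt ((1 - \<alpha>) ^ 2 * real n ^ 2 + (2 * \<alpha> ^ 2 - 6 * \<alpha> + 4) * real n +
                 (\<alpha> ^ 2 + 4 * \<alpha> - 4) - 4 * (1 - \<alpha>) * real k)) / 2 \<longleftrightarrow>
          digraph_iso G (with_proj (K_digraph n k 1))))"
proof -
  define b where "b = (1 - \<alpha>) * n - \<alpha>"
  define c where "c = (1 - \<alpha>) * (real n - k - 1)"
  define t where "t = (sqrt (b^2 + 4 * c) - b) / 2"
  have disc: "(1 - \<alpha>) ^ 2 * real n ^ 2 + (2 * \<alpha> ^ 2 - 6 * \<alpha> + 4) * real n +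
      (\<alpha> ^ 2 + 4 * \<alpha> - 4) - 4 * (1 - \<alpha>) * real k = b^2 + 4 * c"
    by (simp add: b_def c_def power2_eq_square algebra_simps)
  have bound: "(real n - 2 + \<alpha> + \<alpha> * real n +
      sqrt ((1 - \<alpha>) ^ 2 * real n ^ 2 + (2 * \<alpha> ^ 2 - 6 * \<alpha> + 4) * real n +
                 (\<alpha> ^ 2 + 4 * \<alpha> - 4) - 4 * (1 - \<alpha>) * real k)) / 2 = real n - 1 + t"
    unfolding disc by (simp add: t_def b_def field_simps)
  have main: "real n - 1 + t \<le> mu_alpha \<alpha> G vs \<and> (mu_alpha \<alpha> G vs = real n - 1 + t \<longleftrightarrow>
      \<alpha> = 0 \<and> digraph_iso G (with_proj (K_digraph n k (n - k - 1))) \<or>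
      digraph_iso G (with_proj (K_digraph n k 1)))" if \<alpha>: "0 \<le> \<alpha>" "\<alpha> < 1"
  proof -
    have "c > 0" using \<alpha> assms(2,3) by (simp add: c_def)
    note root = positive_root_quadratic[OF this, of b, folded t_def]
    have "k + 2 \<le> n" using assms(3) by simp
    note conn = connectivity_mu_alpha_bound[OF \<open>0 < k\<close> this assms(4-6) \<alpha>
        root(2)[unfolded b_def c_def] root(1)]
    show ?thesis using conn by blast
  qed
  have bound0: "(real n - 2 + sqrt (real n ^ 2 + 4 * real n - 4 * real k - 4)) / 2 = real n - 1 + t"
    if "\<alpha> = 0"
    unfolding bound[symmetric] that by (simp add: algebra_simps)
  show ?thesis using main bound bound0 by auto
qed

end
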